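(* Let $S$ be a free semigroup and let $T\neq\emptyset$ be a subset of $S$. The following two conditions are equivalent: (i) $T$ is a free subsemigroup of $S$ with the property that, for any elements $t\in T$ and $s\in S$, the condition $tst\in T$ implies both $ts\in T$ and $st\in T$; (ii) $T=\mathrm{Sep}T$.
   Context: For a subset $A$ of a semigroup $S$, write $\overline{A}=S\setminus A$. The separator of $A$, denoted $\mathrm{Sep}A$, is the set of all $x\in S$ such that $xA\subseteq A$, $Ax\subseteq A$, $x\overline{A}\subseteq\overline{A}$ and $\overline{A}x\subseteq\overline{A}$. A free semigroup is a semigroup isomorphic to the semigroup of all non-empty finite words over some non-empty alphabet under concatenation (no identity element). A free subsemigroup of $S$ is a subsemigroup of $S$ that is itself a free semigroup. *)

theory Defs
  imports Main
begin

definition semigroup_on :: "'a set \<Rightarrow> ('a \<Rightarrow> 'a \<Rightarrow> 'a) \<Rightarrow> bool" where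
  "semigroup_on S f \<longleftrightarrow>
     (\<forall>x\<in>S. \<forall>y\<in>S. f x y \<in> S) \<and>
     (\<forall>x\<in>S. \<forall>y\<in>S. \<forall>z\<in>S. f (f x y) z = f x (f y z))"

definition nonempty_words :: "'b set \<Rightarrow> 'b list set" where
  "nonempty_words A = lists A - {[]}"

definition word_iso :: "'b set \<Rightarrow> ('b list \<Rightarrow> 'a) \<Rightarrow> 'a set \<Rightarrow> ('a \<Rightarrow> 'a \<Rightarrow> 'a) \<Rightarrow> bool" where
  "word_iso A h S f \<longleftrightarrow>
     bij_betw h (nonempty_words A) S \<and>
     (\<forall>u\<in>nonempty_words A. \<forall>v\<in>nonempty_words A. h (u @ v) = f (h u) (h v))"

text \<open>The alphabet is quantified over subsets of the carrier type. This loses no generality: the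
  letters of any alphabet embed into the semigroup as one-letter words; see
  \<open>free_semigroup_on_if_word_iso\<close> below.\<close>

definition free_semigroup_on :: "'a set \<Rightarrow> ('a \<Rightarrow> 'a \<Rightarrow> 'a) \<Rightarrow> bool" where
  "free_semigroup_on S f \<longleftrightarrow>
     semigroup_on S f \<and> (\<exists>(A :: 'a set) h. A \<noteq> {} \<and> word_iso A h S f)"

definition subsemigroup_on :: "'a set \<Rightarrow> 'a set \<Rightarrow> ('a \<Rightarrow> 'a \<Rightarrow> 'a) \<Rightarrow> bool" where
  "subsemigroup_on T S f \<longleftrightarrow> T \<noteq> {} \<and> T \<subseteq> S \<and> (\<forall>x\<in>T. \<forall>y\<in>T. f x y \<in> T)"

definition free_subsemigroup_on :: "'a set \<Rightarrow> 'a set \<Rightarrow> ('a \<Rightarrow> 'a \<Rightarrow> 'a) \<Rightarrow> bool" where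
  "free_subsemigroup_on T S f \<longleftrightarrow> subsemigroup_on T S f \<and> free_semigroup_on T f"

definition separator :: "'a set \<Rightarrow> ('a \<Rightarrow> 'a \<Rightarrow> 'a) \<Rightarrow> 'a set \<Rightarrow> 'a set" where
  "separator S f A =
     {x \<in> S. (\<lambda>a. f x a) ` A \<subseteq> A \<and> (\<lambda>a. f a x) ` A \<subseteq> A \<and>
             (\<lambda>a. f x a) ` (S - A) \<subseteq> S - A \<and> (\<lambda>a. f a x) ` (S - A) \<subseteq> S - A}"

lemma free_semigroup_on_if_word_iso:
  fixes A :: "'b set" and S :: "'a set"
  assumes S: "semigroup_on S f" and A: "A \<noteq> {}" and h: "word_iso A h S f"
  shows "free_semigroup_on S f"
proof -
  define e where "e = (\<lambda>a. h [a])"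
  have inj_h: "inj_on h (nonempty_words A)"
    using h by (simp add: word_iso_def bij_betw_def)
  have "inj_on e A"
  proof (rule inj_onI)
    fix a b assume "a \<in> A" "b \<in> A" "e a = e b"
    then have "[a] = [b]"
      unfolding e_def by (intro inj_onD[OF inj_h]) (auto simp: nonempty_words_def)
    then show "a = b" by simp
  qed
  then have d_e: "the_inv_into A e (e a) = a" if "a \<in> A" for a
    using that by (rule the_inv_into_f_f)
  define d where "d = the_inv_into A e"
  have "bij_betw (map d) (nonempty_words (e ` A)) (nonempty_words A)"
  proof (rule bij_betw_byWitness[where f' = "map e"])
    show "\<forall>w\<in>nonempty_words (e ` A). map e (map d w) = w"
      by (auto simp: nonempty_words_def d_def d_e intro!: map_idI)
    show "\<forall>w\<in>nonempty_words A. map d (map e w) = w"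
      by (auto simp: nonempty_words_def d_def d_e intro!: map_idI)
    show "map d ` nonempty_words (e ` A) \<subseteq> nonempty_words A"
      by (force simp: nonempty_words_def d_def d_e)
    show "map e ` nonempty_words A \<subseteq> nonempty_words (e ` A)"
      by (auto simp: nonempty_words_def)
  qed
  then have "word_iso (e ` A) (h \<circ> map d) S f"
    using h bij_betwE[of "map d" "nonempty_words (e ` A)" "nonempty_words A"]
    unfolding word_iso_def by (simp add: bij_betw_trans)
  then show ?thesis
    using S A unfolding free_semigroup_on_def
    by (intro conjI exI[of _ "e ` A"] exI[of _ "h \<circ> map d"]) simp_all
qed

end

theory Submission
  imports Defs
begin

text \<open>By Levi's lemma, a non-empty semigroup is free iff it is equidivisible and carries a positive
  additive length. If \<open>T = Sep T\<close>, then \<open>T\<close> is left unitary in \<open>S\<close>, so both properties pass from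
  \<open>S\<close> to \<open>T\<close>. Conversely, if \<open>T\<close> is free and \<open>t\<close>, \<open>ts\<close>, \<open>st\<close> lie in \<open>T\<close>, then equidivisibility of
  \<open>T\<close> applied to \<open>(ts)t = t(st)\<close>, together with left cancellation in \<open>S\<close>, gives \<open>s \<in> T\<close>; with the
  condition on \<open>tst\<close> this yields both inclusions.\<close>

section \<open>Length and equidivisibility\<close>

definition length_on :: "('a \<Rightarrow> nat) \<Rightarrow> 'a set \<Rightarrow> ('a \<Rightarrow> 'a \<Rightarrow> 'a) \<Rightarrow> bool" where
  "length_on l S f \<longleftrightarrow>
     (\<forall>x\<in>S. 0 < l x) \<and> (\<forall>x\<in>S. \<forall>y\<in>S. l (f x y) = l x + l y)"

text \<open>The case \<open>x = y \<and> a = b\<close> stands for an overlap \<open>c\<close> equal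
  to the empty word, which a semigroup without identity cannot supply.\<close>

definition equidivisible_on :: "'a set \<Rightarrow> ('a \<Rightarrow> 'a \<Rightarrow> 'a) \<Rightarrow> bool" where
  "equidivisible_on S f \<longleftrightarrow>
     (\<forall>x\<in>S. \<forall>a\<in>S. \<forall>y\<in>S. \<forall>b\<in>S. f x a = f y b \<longrightarrow>
        x = y \<and> a = b \<or>
        (\<exists>c\<in>S. y = f x c \<and> a = f c b) \<or>
        (\<exists>c\<in>S. x = f y c \<and> b = f c a))"

lemma equidivisible_onE:
  assumes "equidivisible_on S f" "f x a = f y b" "x \<in> S" "a \<in> S" "y \<in> S" "b \<in> S"
  obtains "x = y" "a = b"
    | c where "c \<in> S" "y = f x c" "a = f c b"
    | c where "c \<in> S" "x = f y c" "b = f c a"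
  using assms unfolding equidivisible_on_def by metis

section \<open>Free semigroups have a length and are equidivisible\<close>

lemma word_iso_surj:
  assumes "word_iso A h S f" "x \<in> S"
  obtains u where "u \<in> nonempty_words A" "h u = x"
  using assms unfolding word_iso_def bij_betw_def by blast

lemma append_in_nonempty_words:
  "u \<in> nonempty_words A \<Longrightarrow> v \<in> nonempty_words A \<Longrightarrow> u @ v \<in> nonempty_words A"
  by (auto simp: nonempty_words_def)

text \<open>An element gets the length of the unique word representing it.\<close>

lemma free_semigroup_on_length:
  assumes "free_semigroup_on S f"
  obtains l where "length_on l S f"
proof -
  from assms obtain A :: "'a set" and h where h: "word_iso A h S f"
    unfolding free_semigroup_on_def by blast
  have inj: "inj_on h (nonempty_words A)"
    using h by (simp add: word_iso_def bij_betw_def)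
  define l where "l = (\<lambda>x. length (the_inv_into (nonempty_words A) h x))"
  have l: "l (h u) = length u" if "u \<in> nonempty_words A" for u
    using that inj by (simp add: l_def the_inv_into_f_f)
  have "length_on l S f"
    unfolding length_on_def
  proof (intro conjI ballI)
    fix x assume x: "x \<in> S"
    obtain u where u: "u \<in> nonempty_words A" "h u = x" by (rule word_iso_surj[OF h x])
    then show "0 < l x" using l[OF u(1)] by (auto simp: nonempty_words_def)
    fix y assume y: "y \<in> S"
    obtain v where v: "v \<in> nonempty_words A" "h v = y" by (rule word_iso_surj[OF h y])
    have "f x y = h (u @ v)" using u v h by (simp add: word_iso_def)
    then show "l (f x y) = l x + l y"
      using l[OF u(1)] l[OF v(1)] l[OF append_in_nonempty_words[OF u(1) v(1)]] u v by simp
  qed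
  then show ?thesis by (rule that)
qed

text \<open>Levi's lemma, carried over from words: of two left factors of one word, one is a prefix
  of the other, and the remainder \<open>w\<close> gives the overlap \<open>c\<close>.\<close>

lemma free_semigroup_on_equidivisible:
  assumes "free_semigroup_on S f"
  shows "equidivisible_on S f"
  unfolding equidivisible_on_def
proof (intro ballI impI)
  fix x a y b
  assume S: "x \<in> S" "a \<in> S" "y \<in> S" "b \<in> S" and eq: "f x a = f y b"
  from assms obtain A :: "'a set" and h where h: "word_iso A h S f"
    unfolding free_semigroup_on_def by blast
  let ?W = "nonempty_words A"
  have inj: "inj_on h ?W" and hS: "\<And>u. u \<in> ?W \<Longrightarrow> h u \<in> S"
    and hom: "\<And>u v. u \<in> ?W \<Longrightarrow> v \<in> ?W \<Longrightarrow> h (u @ v) = f (h u) (h v)"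
    using h by (auto simp: word_iso_def bij_betw_def)
  obtain u where u: "u \<in> ?W" "h u = x" by (rule word_iso_surj[OF h S(1)])
  obtain p where p: "p \<in> ?W" "h p = a" by (rule word_iso_surj[OF h S(2)])
  obtain v where v: "v \<in> ?W" "h v = y" by (rule word_iso_surj[OF h S(3)])
  obtain q where q: "q \<in> ?W" "h q = b" by (rule word_iso_surj[OF h S(4)])
  have "h (u @ p) = h (v @ q)" using eq hom u p v q by simp
  then have "u @ p = v @ q"
    by (rule inj_onD[OF inj]) (use append_in_nonempty_words u p v q in auto)
  then obtain w where
    w: "u = v @ w \<and> w @ p = q \<or> u @ w = v \<and> p = w @ q"
    by (auto simp: append_eq_append_conv2)
  show "x = y \<and> a = b \<or>
        (\<exists>c\<in>S. y = f x c \<and> a = f c b) \<or>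
        (\<exists>c\<in>S. x = f y c \<and> b = f c a)"
  proof (cases "w = []")
    case True
    then show ?thesis using w u p v q by auto
  next
    case False
    then have wW: "w \<in> ?W"
      using w u v by (auto simp: nonempty_words_def)
    from w show ?thesis
    proof
      assume "u = v @ w \<and> w @ p = q"
      then have "x = f y (h w)" "b = f (h w) a"
        using hom wW u p v q by auto
      then show ?thesis using hS[OF wW] by blast
    next
      assume "u @ w = v \<and> p = w @ q"
      then have "y = f x (h w)" "a = f (h w) b"
        using hom wW u p v q by auto
      then show ?thesis using hS[OF wW] by blast
    qed
  qed
qed

section \<open>Free generation by the irreducible elements\<close>

text \<open>With no identity available, the recursion bottoms out at one-letter words; the value at
  \<open>[]\<close> is arbitrary and only non-empty words are used.\<close>

fun word_prod :: "('a \<Rightarrow> 'a \<Rightarrow> 'a) \<Rightarrow> 'a list \<Rightarrow> 'a" where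
  "word_prod f [] = undefined"
| "word_prod f [x] = x"
| "word_prod f (x # y # w) = f x (word_prod f (y # w))"

lemma word_prod_Cons: "w \<noteq> [] \<Longrightarrow> word_prod f (x # w) = f x (word_prod f w)"
  by (cases w) auto

lemma word_prod_in:
  assumes "semigroup_on S f" "B \<subseteq> S"
  shows "u \<in> nonempty_words B \<Longrightarrow> word_prod f u \<in> S"
proof (induction u)
  case (Cons x u)
  then show ?case
    using assms by (cases "u = []") (auto simp: word_prod_Cons semigroup_on_def nonempty_words_def)
qed (simp add: nonempty_words_def)

lemma word_prod_append:
  assumes "semigroup_on S f" "B \<subseteq> S" and v: "v \<in> nonempty_words B"
  shows "u \<in> nonempty_words B \<Longrightarrow> word_prod f (u @ v) = f (word_prod f u) (word_prod f v)"
proof (induction u)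
  case (Cons x u)
  have vne: "v \<noteq> []" using v by (simp add: nonempty_words_def)
  show ?case
  proof (cases "u = []")
    case True
    then show ?thesis using vne by (simp add: word_prod_Cons)
  next
    case False
    then have u: "u \<in> nonempty_words B" and x: "x \<in> S"
      using Cons.prems assms by (auto simp: nonempty_words_def)
    have "f (f x (word_prod f u)) (word_prod f v) = f x (f (word_prod f u) (word_prod f v))"
      using assms(1) x word_prod_in[OF assms(1,2)] u v by (simp add: semigroup_on_def)
    then show ?thesis
      using Cons.IH[OF u] False by (simp add: word_prod_Cons)
  qed
qed (simp add: nonempty_words_def)

text \<open>The irreducible elements form a free basis: induction on the length factors every
  element into irreducibles, and equidivisibility makes the factorization unique.\<close>

lemma free_semigroup_on_if_equidivisible:
  assumes S: "semigroup_on S f" "S \<noteq> {}" and l: "length_on l S f" and e: "equidivisible_on S f"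
  shows "free_semigroup_on S f"
proof -
  have clos: "\<And>x y. x \<in> S \<Longrightarrow> y \<in> S \<Longrightarrow> f x y \<in> S"
    using S by (auto simp: semigroup_on_def)
  have lpos: "\<And>x. x \<in> S \<Longrightarrow> 0 < l x"
    and ladd: "\<And>x y. x \<in> S \<Longrightarrow> y \<in> S \<Longrightarrow> l (f x y) = l x + l y"
    using l by (auto simp: length_on_def)
  define B where "B = {x \<in> S. \<not> (\<exists>y\<in>S. \<exists>z\<in>S. x = f y z)}"
  let ?W = "nonempty_words B"
  have BS: "B \<subseteq> S" by (auto simp: B_def)
  have irr: "f y z \<notin> B" if "y \<in> S" "z \<in> S" for y z
    using that by (auto simp: B_def)
  note hS = word_prod_in[OF S(1) BS] and happ = word_prod_append[OF S(1) BS]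
  have surj: "\<exists>u\<in>?W. word_prod f u = x" if "x \<in> S" for x
    using that
  proof (induction "l x" arbitrary: x rule: less_induct)
    case less
    show ?case
    proof (cases "x \<in> B")
      case True
      then show ?thesis by (intro bexI[of _ "[x]"]) (auto simp: nonempty_words_def)
    next
      case False
      then obtain y z where yz: "y \<in> S" "z \<in> S" "x = f y z"
        using less.prems by (auto simp: B_def)
      \<comment> \<open>Positivity of the length makes both factors strictly shorter, so the
        induction applies to each.\<close>
      then have "l y < l x" "l z < l x" using ladd lpos by auto
      then obtain u v where "u \<in> ?W" "word_prod f u = y" "v \<in> ?W" "word_prod f v = z"
        using less.hyps yz by blast
      then show ?thesis
        using yz happ append_in_nonempty_words by (intro bexI[of _ "u @ v"]) auto
    qed
  qed
  have inj: "u = v" if "u \<in> ?W" "v \<in> ?W" "word_prod f u = word_prod f v" for u v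
    using that
  proof (induction u arbitrary: v)
    case Nil
    then show ?case by (simp add: nonempty_words_def)
  next
    case (Cons x u)
    from Cons.prems obtain y w where v: "v = y # w"
      by (cases v) (auto simp: nonempty_words_def)
    have xy: "x \<in> B" "y \<in> B" and tails: "u = [] \<or> u \<in> ?W" "w = [] \<or> w \<in> ?W"
      using Cons.prems v by (auto simp: nonempty_words_def)
    have xyS: "x \<in> S" "y \<in> S" using xy BS by auto
    show ?case
    proof (cases "u = [] \<or> w = []")
      case True
      \<comment> \<open>A one-letter word has its value in \<open>B\<close>, while the value of a
        longer word is a product and so lies outside \<open>B\<close>.\<close>
      have "w = []" if "u = []"
      proof (rule ccontr)
        assume "w \<noteq> []"
        then have "x = f y (word_prod f w)" "w \<in> ?W"
          using Cons.prems(3) v that tails by (auto simp: word_prod_Cons)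
        then show False using irr[OF xyS(2) hS] xy by simp
      qed
      moreover have "u = []" if "w = []"
      proof (rule ccontr)
        assume "u \<noteq> []"
        then have "f x (word_prod f u) = y" "u \<in> ?W"
          using Cons.prems(3) v that tails by (auto simp: word_prod_Cons)
        then show False using irr[OF xyS(1) hS, of u] xy by simp
      qed
      ultimately have "u = []" "w = []" using True by auto
      then show ?thesis using Cons.prems(3) v by simp
    next
      case False
      then have uw: "u \<in> ?W" "w \<in> ?W" using tails by auto
      have "f x (word_prod f u) = f y (word_prod f w)"
        using Cons.prems(3) v False by (simp add: word_prod_Cons)
      then show ?thesis
      proof (rule equidivisible_onE[OF e _ xyS(1) hS[OF uw(1)] xyS(2) hS[OF uw(2)]])
        assume "x = y" "word_prod f u = word_prod f w"
        then show ?thesis using Cons.IH uw v by blast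
      \<comment> \<open>In the two overlap cases one of the letters \<open>x\<close>,
        \<open>y\<close> would be a product, against irreducibility.\<close>
      qed (use xy xyS irr in auto)
    qed
  qed
  have "word_prod f ` ?W = S" using surj hS by blast
  moreover have "inj_on (word_prod f) ?W" using inj by (rule inj_onI)
  ultimately have iso: "word_iso B (word_prod f) S f"
    using happ by (simp add: word_iso_def bij_betw_def)
  have "B \<noteq> {}" using surj S(2) by (fastforce simp: nonempty_words_def)
  then show ?thesis
    using iso S(1) unfolding free_semigroup_on_def by blast
qed

section \<open>Cancellation and subsemigroups of a free semigroup\<close>

text \<open>A proper overlap would give \<open>x = f x c\<close>, which the positive length of
  \<open>c\<close> forbids; only the equality case of equidivisibility is left.\<close>

lemma free_semigroup_on_left_cancel:
  assumes S: "free_semigroup_on S f" and "x \<in> S" "a \<in> S" "b \<in> S" "f x a = f x b"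
  shows "a = b"
proof -
  obtain l where l: "length_on l S f" using S by (rule free_semigroup_on_length)
  have ne: "x \<noteq> f x c" if "c \<in> S" for c
  proof
    assume "x = f x c"
    then have "l x = l x + l c" using l assms(2) that unfolding length_on_def by metis
    then show False using l that by (auto simp: length_on_def)
  qed
  show ?thesis
    using free_semigroup_on_equidivisible[OF S] assms(5,2,3,2,4)
    by (rule equidivisible_onE) (use ne in auto)
qed

text \<open>The length restricts to \<open>T\<close>. An overlap \<open>c\<close> found in
  \<open>S\<close> satisfies \<open>y = f x c\<close> or \<open>x = f y c\<close> with
  \<open>x\<close> and \<open>y\<close> in \<open>T\<close>, so \<open>unit\<close> puts it into
  \<open>T\<close>.\<close>

lemma free_semigroup_on_left_unitary:
  assumes S: "free_semigroup_on S f" and T: "T \<subseteq> S" "T \<noteq> {}"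
    and clos: "\<And>x y. x \<in> T \<Longrightarrow> y \<in> T \<Longrightarrow> f x y \<in> T"
    and unit: "\<And>x s. x \<in> T \<Longrightarrow> s \<in> S \<Longrightarrow> f x s \<in> T \<Longrightarrow> s \<in> T"
  shows "free_semigroup_on T f"
proof -
  obtain l where "length_on l S f" using S by (rule free_semigroup_on_length)
  then have l: "length_on l T f" using T(1) unfolding length_on_def by blast
  have "semigroup_on S f" using S by (simp add: free_semigroup_on_def)
  then have "semigroup_on T f" using T(1) clos unfolding semigroup_on_def by blast
  moreover have "equidivisible_on T f"
    unfolding equidivisible_on_def
  proof (intro ballI impI)
    fix x a y b
    assume xaybT: "x \<in> T" "a \<in> T" "y \<in> T" "b \<in> T" and eq: "f x a = f y b"
    then have "x \<in> S" "a \<in> S" "y \<in> S" "b \<in> S" using T(1) by auto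
    with free_semigroup_on_equidivisible[OF S] eq
    show "x = y \<and> a = b \<or>
          (\<exists>c\<in>T. y = f x c \<and> a = f c b) \<or>
          (\<exists>c\<in>T. x = f y c \<and> b = f c a)"
      by (rule equidivisible_onE) (use xaybT unit in blast)+
  qed
  ultimately show ?thesis using T(2) l by (intro free_semigroup_on_if_equidivisible)
qed

lemma free_subsemigroup_on_stable:
  assumes S: "free_semigroup_on S f" and T: "free_semigroup_on T f" "T \<subseteq> S"
    and t: "t \<in> T" and s: "s \<in> S" and ts: "f t s \<in> T" and st: "f s t \<in> T"
  shows "s \<in> T"
proof -
  obtain l where l: "length_on l S f" using S by (rule free_semigroup_on_length)
  have tS: "t \<in> S" using t T(2) by auto
  have eq: "f (f t s) t = f t (f s t)"
    using S tS s by (simp add: free_semigroup_on_def semigroup_on_def)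
  have len: "l (f t s) = l t + l s" "0 < l s"
    using l tS s by (auto simp: length_on_def)
  \<comment> \<open>In the first two cases \<open>t\<close> would be at least as long as
    \<open>f t s\<close>, which is impossible. In the third, the overlap \<open>c\<close> lies in
    \<open>T\<close> and cancelling \<open>t\<close> shows that it is \<open>s\<close>.\<close>
  from free_semigroup_on_equidivisible[OF T(1)] eq ts t t st
  show ?thesis
  proof (rule equidivisible_onE)
    assume "f t s = t"
    then show ?thesis using len by simp
  next
    fix c assume c: "c \<in> T" "t = f (f t s) c"
    then have "l t = l (f t s) + l c"
      using l ts T(2) unfolding length_on_def by (metis subsetD)
    then show ?thesis using len by simp
  next
    fix c assume c: "c \<in> T" "f t s = f t c"
    then have "s = c"
      using T(2) by (intro free_semigroup_on_left_cancel[OF S tS s]) auto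
    then show ?thesis using c by simp
  qed
qed

theorem theorem13:
  fixes S T :: "'a set" and f :: "'a \<Rightarrow> 'a \<Rightarrow> 'a"
  assumes "free_semigroup_on S f"
    and "T \<subseteq> S" and "T \<noteq> {}"
  shows "(free_subsemigroup_on T S f \<and>
            (\<forall>t\<in>T. \<forall>s\<in>S. f (f t s) t \<in> T \<longrightarrow> f t s \<in> T \<and> f s t \<in> T))
         \<longleftrightarrow> T = separator S f T"
proof
  have Sclos: "\<And>x y. x \<in> S \<Longrightarrow> y \<in> S \<Longrightarrow> f x y \<in> S"
    and assoc: "\<And>x y z. x \<in> S \<Longrightarrow> y \<in> S \<Longrightarrow> z \<in> S \<Longrightarrow> f (f x y) z = f x (f y z)"
    using assms(1) by (auto simp: free_semigroup_on_def semigroup_on_def)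
  {
    assume L: "free_subsemigroup_on T S f \<and>
      (\<forall>t\<in>T. \<forall>s\<in>S. f (f t s) t \<in> T \<longrightarrow> f t s \<in> T \<and> f s t \<in> T)"
    then have Tfree: "free_semigroup_on T f" and clos: "\<And>x y. x \<in> T \<Longrightarrow> y \<in> T \<Longrightarrow> f x y \<in> T"
      and cond: "\<And>t s. t \<in> T \<Longrightarrow> s \<in> S \<Longrightarrow> f (f t s) t \<in> T \<Longrightarrow> f t s \<in> T \<and> f s t \<in> T"
      unfolding free_subsemigroup_on_def subsemigroup_on_def by blast+
    note stable = free_subsemigroup_on_stable[OF assms(1) Tfree assms(2)]
    \<comment> \<open>Closure turns \<open>f t s \<in> T\<close> into
      \<open>f (f t s) t \<in> T\<close>; \<open>cond\<close> then supplies
      \<open>f s t \<in> T\<close>, as \<open>stable\<close> requires.\<close>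
    have lu: "s \<in> T" if "t \<in> T" "s \<in> S" "f t s \<in> T" for t s
      using that stable cond clos by blast
    have ru: "s \<in> T" if "t \<in> T" "s \<in> S" "f s t \<in> T" for t s
    proof -
      have "f (f t s) t = f t (f s t)" using assoc that assms(2) by auto
      then have "f (f t s) t \<in> T" using clos that by simp
      then show ?thesis using that stable cond by blast
    qed
    show "T = separator S f T"
    proof
      show "T \<subseteq> separator S f T"
        \<comment> \<open>The inclusions for \<open>T\<close> are closure; those for the complement
          are the contrapositives of \<open>lu\<close> and \<open>ru\<close>.\<close>
        using lu ru clos Sclos assms(2) unfolding separator_def by blast
      show "separator S f T \<subseteq> T"
      proof
        fix x assume x: "x \<in> separator S f T"
        obtain t where "t \<in> T" using assms(3) by auto
        then show "x \<in> T" using x stable[of t x] by (auto simp: separator_def)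
      qed
    qed
  }
  assume R: "T = separator S f T"
  note sep = equalityD1[OF R, THEN subsetD]
  have clos: "f x y \<in> T" if "x \<in> T" "y \<in> T" for x y
    using sep[OF that(1)] that by (auto simp: separator_def)
  \<comment> \<open>If \<open>s\<close> were in the complement of \<open>T\<close>, the separator
    element \<open>t\<close> would keep \<open>f t s\<close> there.\<close>
  have lu: "s \<in> T" if "t \<in> T" "s \<in> S" "f t s \<in> T" for t s
    using sep[OF that(1)] that unfolding separator_def by blast
  have ru: "s \<in> T" if "t \<in> T" "s \<in> S" "f s t \<in> T" for t s
    using sep[OF that(1)] that unfolding separator_def by blast
  have "free_subsemigroup_on T S f"
    using free_semigroup_on_left_unitary[OF assms clos lu] clos assms(2,3)
    by (auto simp: free_subsemigroup_on_def subsemigroup_on_def)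
  moreover have "f t s \<in> T \<and> f s t \<in> T" if "t \<in> T" "s \<in> S" "f (f t s) t \<in> T" for t s
  proof
    have tS: "t \<in> S" using that assms(2) by auto
    \<comment> \<open>The product \<open>tst\<close> is read as \<open>(ts)t\<close> to remove the
      right factor, and below as \<open>t(st)\<close> to remove the left one.\<close>
    show "f t s \<in> T" using ru[of t "f t s"] Sclos tS that by simp
    show "f s t \<in> T" using lu[of t "f s t"] Sclos assoc tS that by simp
  qed
  ultimately show "free_subsemigroup_on T S f \<and>
    (\<forall>t\<in>T. \<forall>s\<in>S. f (f t s) t \<in> T \<longrightarrow> f t s \<in> T \<and> f s t \<in> T)"
    by blast
qed

end
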